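(* For all sufficiently large even integers $n$, $$t(n) \geq 0.1339\, n^2 .$$
   Context: For a positive integer $n$ let $[n]=\{1,\dots,n\}$. The $n\times n$ torus $\mathbb{T}_n$ is the hypergraph with vertex set $[n]\times[n]$ whose hyperedges are: the rows $\{i\}\times[n]$ for $i\in[n]$; the columns $[n]\times\{j\}$ for $j\in[n]$; the $\mathbb{Z}_n$-diagonals $\{(i,j)\in[n]\times[n] : i-j\equiv k \pmod n\}$ for $k\in\mathbb{Z}_n$; and the $\mathbb{Z}_n$-skew-diagonals $\{(i,j)\in[n]\times[n] : i+j\equiv k \pmod n\}$ for $k\in\mathbb{Z}_n$. A peaceful battle on $\mathbb{T}_n$ is a pair $(B,W)$ of disjoint subsets of $[n]\times[n]$ such that $e\cap B=\emptyset$ or $e\cap W=\emptyset$ for every hyperedge $e$ of $\mathbb{T}_n$. The number $t(n)$ is the maximum integer $m$ such that there is a peaceful battle $(B,W)$ on $\mathbb{T}_n$ with $|B|=|W|=m$. *)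

theory Defs
  imports Complex_Main "HOL-Number_Theory.Cong"
begin

definition torus_vertices :: "nat \<Rightarrow> (nat \<times> nat) set" where
  "torus_vertices n = {1..n} \<times> {1..n}"

(* Coordinates are cast to int so that i - j is not truncated subtraction; k ranges over all
   integers as a representative of a class in Z_n, and congruent k give the same set. *)
definition diagonal :: "nat \<Rightarrow> int \<Rightarrow> (nat \<times> nat) set" where
  "diagonal n k = {(i, j) \<in> torus_vertices n. [int i - int j = k] (mod int n)}"

definition skew_diagonal :: "nat \<Rightarrow> int \<Rightarrow> (nat \<times> nat) set" where
  "skew_diagonal n k = {(i, j) \<in> torus_vertices n. [int i + int j = k] (mod int n)}"

definition torus_hyperedges :: "nat \<Rightarrow> (nat \<times> nat) set set" where
  "torus_hyperedges n =
     {{i} \<times> {1..n} | i. i \<in> {1..n}} \<union> {{1..n} \<times> {j} | j. j \<in> {1..n}} \<union>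
     range (diagonal n) \<union> range (skew_diagonal n)"

definition peaceful_battle :: "nat \<Rightarrow> (nat \<times> nat) set \<Rightarrow> (nat \<times> nat) set \<Rightarrow> bool" where
  "peaceful_battle n B W \<longleftrightarrow>
     B \<subseteq> torus_vertices n \<and> W \<subseteq> torus_vertices n \<and> B \<inter> W = {} \<and>
     (\<forall>e \<in> torus_hyperedges n. e \<inter> B = {} \<or> e \<inter> W = {})"

definition peaceful_sizes :: "nat \<Rightarrow> nat set" where
  "peaceful_sizes n = {m. \<exists>B W. peaceful_battle n B W \<and> card B = m \<and> card W = m}"

definition torus_t :: "nat \<Rightarrow> nat" where
  "torus_t n = Max (peaceful_sizes n)"

(* The maximum is taken over a finite nonempty set, so Max is meaningful. *)

lemma peaceful_sizes_nonempty: "peaceful_sizes n \<noteq> {}"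
proof -
  have "peaceful_battle n {} {}"
    by (simp add: peaceful_battle_def)
  then have "0 \<in> peaceful_sizes n"
    unfolding peaceful_sizes_def by (intro CollectI exI[of _ "{}"]) simp
  then show ?thesis by blast
qed

lemma finite_peaceful_sizes: "finite (peaceful_sizes n)"
proof (rule finite_subset)
  have "finite (torus_vertices n)"
    by (simp add: torus_vertices_def)
  then show "peaceful_sizes n \<subseteq> {..card (torus_vertices n)}"
    by (auto simp: peaceful_sizes_def peaceful_battle_def intro: card_mono)
qed simp

end

theory Submission
  imports Defs
begin

text \<open>
  On a torus of even side \<open>n = 2 * h\<close> the parity of \<open>i + j\<close> is constant along every diagonal and
  every skew diagonal.  Hence Black cells with \<open>i + j\<close> even and White cells with \<open>i + j\<close> odd can
  only meet in a row or in a column.  Black is given the \<open>k * k\<close> cells lying in the first \<open>k\<close>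
  even rows and the first \<open>k\<close> even columns.  This leaves White every cell with \<open>i + j\<close> odd whose
  even coordinate exceeds \<open>2 * k\<close>: there are \<open>2 * h * (h - k)\<close> of them, half in odd rows and
  half in odd columns.

  With \<open>k = a * h\<close> the two armies balance when \<open>a\<^sup>2 = 2 * (1 - a)\<close>, that is \<open>a = sqrt 3 - 1\<close>,
  and their common size is then \<open>(sqrt 3 - 1)\<^sup>2 * n\<^sup>2 / 4 = (1 - sqrt 3 / 2) * n\<^sup>2\<close>,
  where \<open>1 - sqrt 3 / 2 = 0.13397\<dots>\<close>.  The rational value \<open>a = 0.732\<close>, slightly below
  \<open>sqrt 3 - 1\<close>, already gives a black army of density \<open>0.732\<^sup>2 / 4 = 0.133956\<close>; the margin over
  \<open>0.1339\<close> absorbs the rounding of \<open>a * h\<close> to an integer once \<open>n\<close> is large.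
\<close>

text \<open>
  Surplus soldiers of either side can be dismissed without breaking the peace, so the smaller
  army alone bounds \<^const>\<open>torus_t\<close> from below.
\<close>
lemma torus_t_ge:
  assumes battle: "peaceful_battle n B W" and "m \<le> card B" "m \<le> card W"
  shows "m \<le> torus_t n"
proof -
  obtain B' where B': "B' \<subseteq> B" "card B' = m"
    using assms by (meson obtain_subset_with_card_n)
  obtain W' where W': "W' \<subseteq> W" "card W' = m"
    using assms by (meson obtain_subset_with_card_n)
  have bw: "B \<subseteq> torus_vertices n" "W \<subseteq> torus_vertices n" "B \<inter> W = {}"
    using battle by (simp_all add: peaceful_battle_def)
  have "peaceful_battle n B' W'"
    unfolding peaceful_battle_def
  proof (intro conjI ballI)
    show "B' \<subseteq> torus_vertices n" "W' \<subseteq> torus_vertices n" "B' \<inter> W' = {}"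
      using bw B'(1) W'(1) by blast+
    fix e
    assume "e \<in> torus_hyperedges n"
    then have "e \<inter> B = {} \<or> e \<inter> W = {}"
      using battle unfolding peaceful_battle_def by simp
    then show "e \<inter> B' = {} \<or> e \<inter> W' = {}"
      using B'(1) W'(1) by blast
  qed
  then have "m \<in> peaceful_sizes n"
    using B'(2) W'(2) unfolding peaceful_sizes_def by blast
  then show ?thesis
    unfolding torus_t_def by (simp add: finite_peaceful_sizes)
qed

lemma diagonal_parity:
  assumes "even n" "(i, j) \<in> diagonal n k"
  shows "even (i + j) \<longleftrightarrow> even k"
proof -
  have "int n dvd (int i - int j) - k"
    using assms(2) by (auto simp: diagonal_def cong_iff_dvd_diff)
  moreover have "(2::int) dvd int n"
    using assms(1) by simp
  ultimately have "even ((int i - int j) - k)"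
    by (meson dvd_trans)
  then show ?thesis
    by simp
qed

lemma skew_diagonal_parity:
  assumes "even n" "(i, j) \<in> skew_diagonal n k"
  shows "even (i + j) \<longleftrightarrow> even k"
proof -
  have "int n dvd (int i + int j) - k"
    using assms(2) by (auto simp: skew_diagonal_def cong_iff_dvd_diff)
  moreover have "(2::int) dvd int n"
    using assms(1) by simp
  ultimately have "even ((int i + int j) - k)"
    by (meson dvd_trans)
  then show ?thesis
    by simp
qed

text \<open>
  On an even torus, opposite parities of \<open>i + j\<close> take care of both families of diagonals at once,
  which leaves only rows and columns to be separated.
\<close>
lemma peaceful_battle_opposite_parity:
  assumes "even n" "B \<subseteq> torus_vertices n" "W \<subseteq> torus_vertices n"
    and B_even: "\<And>i j. (i, j) \<in> B \<Longrightarrow> even (i + j)"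
    and W_odd: "\<And>i j. (i, j) \<in> W \<Longrightarrow> odd (i + j)"
    and rows: "fst ` B \<inter> fst ` W = {}"
    and columns: "snd ` B \<inter> snd ` W = {}"
  shows "peaceful_battle n B W"
proof -
  have row: "{i} \<times> {1..n} \<inter> B = {} \<or> {i} \<times> {1..n} \<inter> W = {}" for i
    using rows by force
  have column: "{1..n} \<times> {j} \<inter> B = {} \<or> {1..n} \<times> {j} \<inter> W = {}" for j
    using columns by force
  have constant_parity: "e \<inter> B = {} \<or> e \<inter> W = {}"
    if e: "\<And>i j. (i, j) \<in> e \<Longrightarrow> even (i + j) \<longleftrightarrow> P" for e P
  proof (cases P)
    case True
    have "(i, j) \<notin> W" if "(i, j) \<in> e" for i j
      using e[OF that] W_odd True by blast
    then show ?thesis by auto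
  next
    case False
    have "(i, j) \<notin> B" if "(i, j) \<in> e" for i j
      using e[OF that] B_even False by blast
    then show ?thesis by auto
  qed
  have diag: "diagonal n k \<inter> B = {} \<or> diagonal n k \<inter> W = {}" for k
    using diagonal_parity[OF \<open>even n\<close>] by (rule constant_parity)
  have skew: "skew_diagonal n k \<inter> B = {} \<or> skew_diagonal n k \<inter> W = {}" for k
    using skew_diagonal_parity[OF \<open>even n\<close>] by (rule constant_parity)
  have "B \<inter> W = {}"
    using rows by blast
  moreover have "e \<inter> B = {} \<or> e \<inter> W = {}" if "e \<in> torus_hyperedges n" for e
  proof -
    consider i where "e = {i} \<times> {1..n}" | j where "e = {1..n} \<times> {j}"
      | k where "e = diagonal n k" | k where "e = skew_diagonal n k"
      using \<open>e \<in> torus_hyperedges n\<close> unfolding torus_hyperedges_def by blast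
    then show ?thesis
      by cases (simp_all only: row column diag skew)
  qed
  ultimately show ?thesis
    using assms(2,3) unfolding peaceful_battle_def by simp
qed

text \<open>
  The construction with a free parameter \<open>k\<close>.  The inequality \<open>size\<close> says that the black army
  is not the larger one.
\<close>
lemma square_le_torus_t:
  assumes "k \<le> h" and size: "k\<^sup>2 \<le> 2 * h * (h - k)"
  shows "k\<^sup>2 \<le> torus_t (2 * h)"
proof -
  define low where "low = (\<lambda>x::nat. 2 * x) ` {1..k}"
  define high where "high = (\<lambda>x::nat. 2 * x) ` {k<..h}"
  define odds where "odds = (\<lambda>x::nat. 2 * x + 1) ` {..<h}"
  define B where "B = low \<times> low"
  define W where "W = odds \<times> high \<union> high \<times> odds"
  have card: "card low = k" "card high = h - k" "card odds = h"
    unfolding low_def high_def odds_def by (subst card_image; simp add: inj_on_def)+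
  have fin: "finite high" "finite odds"
    unfolding high_def odds_def by auto
  have range: "low \<subseteq> {1..2 * h}" "high \<subseteq> {1..2 * h}" "odds \<subseteq> {1..2 * h}"
    using \<open>k \<le> h\<close> by (auto simp: low_def high_def odds_def)
  have parity: "x \<in> low \<Longrightarrow> even x" "x \<in> high \<Longrightarrow> even x" "x \<in> odds \<Longrightarrow> odd x" for x
    by (auto simp: low_def high_def odds_def)
  have disj: "low \<inter> high = {}" "low \<inter> odds = {}" "odds \<inter> high = {}"
    using parity by (auto simp: low_def high_def disjoint_iff)
  have "peaceful_battle (2 * h) B W"
  proof (rule peaceful_battle_opposite_parity)
    show "B \<subseteq> torus_vertices (2 * h)" "W \<subseteq> torus_vertices (2 * h)"
      using range unfolding B_def W_def torus_vertices_def by blast+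
    show "even (i + j)" if "(i, j) \<in> B" for i j
      using that parity by (auto simp: B_def)
    show "odd (i + j)" if "(i, j) \<in> W" for i j
      using that parity by (auto simp: W_def)
    show "fst ` B \<inter> fst ` W = {}" "snd ` B \<inter> snd ` W = {}"
      using disj unfolding B_def W_def by auto
  qed simp
  moreover have "card B = k\<^sup>2"
    by (simp add: B_def card_cartesian_product card power2_eq_square)
  moreover have "card W = 2 * h * (h - k)"
  proof -
    have "card W = card (odds \<times> high) + card (high \<times> odds)"
      unfolding W_def using fin disj(3) by (intro card_Un_disjoint) auto
    then show ?thesis
      by (simp add: card_cartesian_product card)
  qed
  ultimately show ?thesis
    using size by (intro torus_t_ge[of "2 * h" B W]) auto
qed

theorem theorem1p1:
  shows "\<exists>N::nat. \<forall>n\<ge>N. even n \<longrightarrow> real (torus_t n) \<ge> 0.1339 * (real n)\<^sup>2"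
proof (intro exI[of _ 20000] allI impI)
  fix n :: nat
  assume "20000 \<le> n" and "even n"
  obtain h where n: "n = 2 * h"
    using \<open>even n\<close> by (rule evenE)
  have h: "10000 \<le> h"
    using \<open>20000 \<le> n\<close> n by linarith
  \<comment> \<open>\<open>183 / 250 = 0.732\<close>, just below the optimal ratio \<open>sqrt 3 - 1\<close>\<close>
  define k where "k = 183 * h div 250"
  have "250 * k \<le> 183 * h" "183 * h < 250 * k + 250"
    unfolding k_def by linarith+
  then have "real (250 * k) \<le> real (183 * h)" "real (183 * h) < real (250 * k + 250)"
    by (simp_all only: of_nat_le_iff of_nat_less_iff)
  then have k_upper: "real k \<le> 183 / 250 * real h" and k_lower: "183 / 250 * real h - 1 \<le> real k"
    by simp_all
  have "k \<le> h"
    using \<open>250 * k \<le> 183 * h\<close> by linarith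
  have "(real k)\<^sup>2 \<le> (183 / 250 * real h)\<^sup>2"
    using k_upper by (intro power_mono) auto
  also have "\<dots> = (183 / 250)\<^sup>2 * (real h)\<^sup>2"
    by (rule power_mult_distrib)
  \<comment> \<open>the balance inequality \<open>a\<^sup>2 \<le> 2 * (1 - a)\<close> at \<open>a = 183 / 250\<close>\<close>
  also have "\<dots> \<le> 2 * (67 / 250) * (real h)\<^sup>2"
    by (intro mult_right_mono) (simp_all add: power2_eq_square)
  also have "\<dots> = 2 * real h * (67 / 250 * real h)"
    by (simp add: power2_eq_square)
  also have "\<dots> \<le> 2 * real h * (real h - real k)"
    using k_upper by (intro mult_left_mono) auto
  also have "\<dots> = real (2 * h * (h - k))"
    using \<open>k \<le> h\<close> by (simp add: of_nat_diff)
  finally have "real (k\<^sup>2) \<le> real (2 * h * (h - k))"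
    by simp
  then have "k\<^sup>2 \<le> 2 * h * (h - k)"
    by (simp only: of_nat_le_iff)
  then have bound: "k\<^sup>2 \<le> torus_t n"
    unfolding n using \<open>k \<le> h\<close> by (intro square_le_torus_t)
  \<comment> \<open>\<open>0.73185\<close> lies between \<open>sqrt (4 * 0.1339)\<close> and \<open>0.732\<close>; the gap times \<open>h\<close> exceeds \<open>1\<close>\<close>
  have "0.1339 * (real n)\<^sup>2 = (4 * 0.1339) * (real h)\<^sup>2"
    by (simp add: n power_mult_distrib)
  also have "\<dots> \<le> (73185 / 100000)\<^sup>2 * (real h)\<^sup>2"
    by (intro mult_right_mono) (simp_all add: power2_eq_square)
  also have "\<dots> = (73185 / 100000 * real h)\<^sup>2"
    by (rule power_mult_distrib[symmetric])
  also have "\<dots> \<le> (real k)\<^sup>2"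
  proof (rule power_mono)
    have "10000 \<le> real h"
      using h by simp
    then show "73185 / 100000 * real h \<le> real k"
      using k_lower by linarith
  qed simp
  also have "\<dots> = real (k\<^sup>2)"
    by simp
  also have "\<dots> \<le> real (torus_t n)"
    using bound by (simp only: of_nat_le_iff)
  finally show "0.1339 * (real n)\<^sup>2 \<le> real (torus_t n)" .
qed

end
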